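(* Let $a_1,b_1,a_2,b_2>0$ be real numbers. With $a_+,b_+$ and the partial sums $K_{1,N},K_{2,N}$ (and their limits $K_{1,\infty},K_{2,\infty}$ as $N\to\infty$) defined from $a_1,b_1,a_2,b_2$ as in the context, denote by $R_{1,N}$ and $R_{2,N}$ the remainders $$R_{1,N}=K_{1,\infty}-K_{1,N}\quad\text{and}\quad R_{2,N}=K_{2,\infty}-K_{2,N}.$$ Then for every integer $N>1$: $$R_{1,N}\leqslant\frac{1}{4a_+b_+(N-1)}\,e^{-8a_+b_+(N-1)^2},$$ $$R_{2,N}\leqslant\left(\frac{2}{\pi}\right)^{3/2}\frac{\sqrt{a_+b_+}}{N}\;e^{2a_+b_+}\,e^{-\frac{\pi^2N^2}{2a_+b_+}}.$$
   Context: For real numbers $a_1,b_1,a_2,b_2>0$, set $$a_+=\frac{a_1+a_2}{2},\quad b_+=\frac{b_1+b_2}{2},\quad c=\frac{a_1b_1-a_2b_2}{2},\quad d=\frac{a_1b_2-a_2b_1}{2},$$ and, for integers $n\geqslant 1$, $$A_n=n^2a_2b_2+(n-1)^2a_1b_1+n(n-1)(a_2b_1+a_1b_2),$$ $$B_n=(n-1)^2a_2b_2+n^2a_1b_1+n(n-1)(a_2b_1+a_1b_2),$$ $$C_n=n^2(a_1b_1+a_2b_2)+n(n-1)a_2b_1+n(n+1)a_1b_2,$$ $$D_n=n^2(a_1b_1+a_2b_2)+n(n+1)a_2b_1+n(n-1)a_1b_2.$$ For $N\geqslant 1$ (including $N=\infty$, where the sums are the corresponding convergent infinite series), define $$K_{1,N}=1-\sum_{n=1}^{N}\left(e^{-2A_n}+e^{-2B_n}-e^{-2C_n}-e^{-2D_n}\right),$$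 $$K_{2,N}=\sqrt{\frac{\pi}{2a_+b_+}}\;e^{\frac{d^2}{2a_+b_+}}\sum_{n=1}^{N}\left(e^{-\frac{\pi^2(2n)^2}{8a_+b_+}}\left(\cos\left(\frac{\pi(2n)d}{2a_+b_+}\right)-\cos\left(\frac{\pi(2n)c}{2a_+b_+}\right)\right)+e^{-\frac{\pi^2(2n-1)^2}{8a_+b_+}}\left(\cos\left(\frac{\pi(2n-1)d}{2a_+b_+}\right)+\cos\left(\frac{\pi(2n-1)c}{2a_+b_+}\right)\right)\right).$$ *)

theory Defs
  imports Complex_Main
begin

definition a_plus :: "real \<Rightarrow> real \<Rightarrow> real" where
  "a_plus a1 a2 = (a1 + a2) / 2"

definition b_plus :: "real \<Rightarrow> real \<Rightarrow> real" where
  "b_plus b1 b2 = (b1 + b2) / 2"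

definition c_par :: "real \<Rightarrow> real \<Rightarrow> real \<Rightarrow> real \<Rightarrow> real" where
  "c_par a1 b1 a2 b2 = (a1 * b1 - a2 * b2) / 2"

definition d_par :: "real \<Rightarrow> real \<Rightarrow> real \<Rightarrow> real \<Rightarrow> real" where
  "d_par a1 b1 a2 b2 = (a1 * b2 - a2 * b1) / 2"

definition A_seq :: "real \<Rightarrow> real \<Rightarrow> real \<Rightarrow> real \<Rightarrow> nat \<Rightarrow> real" where
  "A_seq a1 b1 a2 b2 n =
     (real n)\<^sup>2 * a2 * b2 + (real n - 1)\<^sup>2 * a1 * b1
       + real n * (real n - 1) * (a2 * b1 + a1 * b2)"

definition B_seq :: "real \<Rightarrow> real \<Rightarrow> real \<Rightarrow> real \<Rightarrow> nat \<Rightarrow> real" where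
  "B_seq a1 b1 a2 b2 n =
     (real n - 1)\<^sup>2 * a2 * b2 + (real n)\<^sup>2 * a1 * b1
       + real n * (real n - 1) * (a2 * b1 + a1 * b2)"

definition C_seq :: "real \<Rightarrow> real \<Rightarrow> real \<Rightarrow> real \<Rightarrow> nat \<Rightarrow> real" where
  "C_seq a1 b1 a2 b2 n =
     (real n)\<^sup>2 * (a1 * b1 + a2 * b2)
       + real n * (real n - 1) * a2 * b1 + real n * (real n + 1) * a1 * b2"

definition D_seq :: "real \<Rightarrow> real \<Rightarrow> real \<Rightarrow> real \<Rightarrow> nat \<Rightarrow> real" where
  "D_seq a1 b1 a2 b2 n =
     (real n)\<^sup>2 * (a1 * b1 + a2 * b2)
       + real n * (real n + 1) * a2 * b1 + real n * (real n - 1) * a1 * b2"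

definition K1_term :: "real \<Rightarrow> real \<Rightarrow> real \<Rightarrow> real \<Rightarrow> nat \<Rightarrow> real" where
  "K1_term a1 b1 a2 b2 n =
     exp (- 2 * A_seq a1 b1 a2 b2 n) + exp (- 2 * B_seq a1 b1 a2 b2 n)
       - exp (- 2 * C_seq a1 b1 a2 b2 n) - exp (- 2 * D_seq a1 b1 a2 b2 n)"

definition K2_factor :: "real \<Rightarrow> real \<Rightarrow> real \<Rightarrow> real \<Rightarrow> real" where
  "K2_factor a1 b1 a2 b2 =
     (let ap = a_plus a1 a2; bp = b_plus b1 b2; d = d_par a1 b1 a2 b2
      in sqrt (pi / (2 * ap * bp)) * exp (d\<^sup>2 / (2 * ap * bp)))"

definition K2_term :: "real \<Rightarrow> real \<Rightarrow> real \<Rightarrow> real \<Rightarrow> nat \<Rightarrow> real" where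
  "K2_term a1 b1 a2 b2 n =
     (let ap = a_plus a1 a2; bp = b_plus b1 b2;
          c = c_par a1 b1 a2 b2; d = d_par a1 b1 a2 b2
      in exp (- (pi\<^sup>2 * (2 * real n)\<^sup>2) / (8 * ap * bp))
           * (cos (pi * (2 * real n) * d / (2 * ap * bp))
              - cos (pi * (2 * real n) * c / (2 * ap * bp)))
       + exp (- (pi\<^sup>2 * (2 * real n - 1)\<^sup>2) / (8 * ap * bp))
           * (cos (pi * (2 * real n - 1) * d / (2 * ap * bp))
              + cos (pi * (2 * real n - 1) * c / (2 * ap * bp))))"

definition K1 :: "real \<Rightarrow> real \<Rightarrow> real \<Rightarrow> real \<Rightarrow> nat \<Rightarrow> real" where
  "K1 a1 b1 a2 b2 N = 1 - (\<Sum>n = 1..N. K1_term a1 b1 a2 b2 n)"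

definition K2 :: "real \<Rightarrow> real \<Rightarrow> real \<Rightarrow> real \<Rightarrow> nat \<Rightarrow> real" where
  "K2 a1 b1 a2 b2 N = K2_factor a1 b1 a2 b2 * (\<Sum>n = 1..N. K2_term a1 b1 a2 b2 n)"

text \<open>The series start at index 1, hence the shift by \<open>Suc\<close>. They converge for positive
  parameters, so \<open>suminf\<close> is not a junk value there; see the limit lemmas at the end.\<close>

definition K1_inf :: "real \<Rightarrow> real \<Rightarrow> real \<Rightarrow> real \<Rightarrow> real" where
  "K1_inf a1 b1 a2 b2 = 1 - (\<Sum>n. K1_term a1 b1 a2 b2 (Suc n))"

definition K2_inf :: "real \<Rightarrow> real \<Rightarrow> real \<Rightarrow> real \<Rightarrow> real" where
  "K2_inf a1 b1 a2 b2 = K2_factor a1 b1 a2 b2 * (\<Sum>n. K2_term a1 b1 a2 b2 (Suc n))"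

definition R1 :: "real \<Rightarrow> real \<Rightarrow> real \<Rightarrow> real \<Rightarrow> nat \<Rightarrow> real" where
  "R1 a1 b1 a2 b2 N = K1_inf a1 b1 a2 b2 - K1 a1 b1 a2 b2 N"

definition R2 :: "real \<Rightarrow> real \<Rightarrow> real \<Rightarrow> real \<Rightarrow> nat \<Rightarrow> real" where
  "R2 a1 b1 a2 b2 N = K2_inf a1 b1 a2 b2 - K2 a1 b1 a2 b2 N"

lemma summable_exp_linear_bound:
  fixes X :: "nat \<Rightarrow> real"
  assumes "k > 0" and le: "\<And>n. X n \<le> - (k * real n)"
  shows "summable (\<lambda>n. exp (X n))"
proof (rule summable_comparison_test')
  show "summable (\<lambda>n. exp (- k) ^ n)"
    using assms(1) by (intro summable_geometric) simp
  show "norm (exp (X n)) \<le> exp (- k) ^ n" if "n \<ge> 0" for n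
    using le[of n] by (simp add: exp_of_nat_mult[symmetric] mult.commute)
qed

lemma summable_K1_term:
  assumes "a1 > 0" "b1 > 0" "a2 > 0" "b2 > 0"
  shows "summable (\<lambda>n. K1_term a1 b1 a2 b2 (Suc n))"
proof -
  have p: "a1 * b1 > 0" "a2 * b2 > 0" "a2 * b1 > 0" "a1 * b2 > 0"
    using assms by auto
  have sq: "real n \<le> (real n + 1)\<^sup>2" for n
    by (simp add: power2_eq_square algebra_simps)
  have lower: "k * real n \<le> 2 * (k * (real n + 1)\<^sup>2 + r)" if "k > 0" "r \<ge> 0" for k r :: real and n
  proof -
    have "k * real n \<le> k * (real n + 1)\<^sup>2"
      using that(1) sq by (intro mult_left_mono) auto
    moreover have "0 \<le> k * (real n + 1)\<^sup>2" using that(1) by simp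
    moreover have "x \<le> 2 * (y + r)" if "x \<le> y" "0 \<le> y" "0 \<le> r" for x y r :: real
      using that by (simp add: distrib_left)
    ultimately show ?thesis using that(2) by blast
  qed
  have A: "summable (\<lambda>n. exp (- 2 * A_seq a1 b1 a2 b2 (Suc n)))"
  proof (rule summable_exp_linear_bound[OF p(2)])
    fix n
    let ?r = "(real n)\<^sup>2 * (a1 * b1)
             + (real n + 1) * real n * (a2 * b1 + a1 * b2)"
    have "A_seq a1 b1 a2 b2 (Suc n) = a2 * b2 * (real n + 1)\<^sup>2 + ?r"
      by (simp add: A_seq_def power2_eq_square algebra_simps)
    moreover have "?r \<ge> 0"
      using assms by (intro add_nonneg_nonneg mult_nonneg_nonneg) auto
    ultimately show "- 2 * A_seq a1 b1 a2 b2 (Suc n) \<le> - (a2 * b2 * real n)"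
      using lower[OF p(2), of ?r n] by simp
  qed
  have B: "summable (\<lambda>n. exp (- 2 * B_seq a1 b1 a2 b2 (Suc n)))"
  proof (rule summable_exp_linear_bound[OF p(1)])
    fix n
    let ?r = "(real n)\<^sup>2 * (a2 * b2)
             + (real n + 1) * real n * (a2 * b1 + a1 * b2)"
    have "B_seq a1 b1 a2 b2 (Suc n) = a1 * b1 * (real n + 1)\<^sup>2 + ?r"
      by (simp add: B_seq_def power2_eq_square algebra_simps)
    moreover have "?r \<ge> 0"
      using assms by (intro add_nonneg_nonneg mult_nonneg_nonneg) auto
    ultimately show "- 2 * B_seq a1 b1 a2 b2 (Suc n) \<le> - (a1 * b1 * real n)"
      using lower[OF p(1), of ?r n] by simp
  qed
  have C: "summable (\<lambda>n. exp (- 2 * C_seq a1 b1 a2 b2 (Suc n)))"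
  proof (rule summable_exp_linear_bound[OF p(1)])
    fix n
    let ?r = "(real n + 1)\<^sup>2 * (a2 * b2)
             + (real n + 1) * real n * (a2 * b1)
             + (real n + 1) * (real n + 2) * (a1 * b2)"
    have "C_seq a1 b1 a2 b2 (Suc n) = a1 * b1 * (real n + 1)\<^sup>2 + ?r"
      by (simp add: C_seq_def power2_eq_square algebra_simps)
    moreover have "?r \<ge> 0"
      using assms by (intro add_nonneg_nonneg mult_nonneg_nonneg) auto
    ultimately show "- 2 * C_seq a1 b1 a2 b2 (Suc n) \<le> - (a1 * b1 * real n)"
      using lower[OF p(1), of ?r n] by simp
  qed
  have D: "summable (\<lambda>n. exp (- 2 * D_seq a1 b1 a2 b2 (Suc n)))"
  proof (rule summable_exp_linear_bound[OF p(1)])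
    fix n
    let ?r = "(real n + 1)\<^sup>2 * (a2 * b2)
             + (real n + 1) * (real n + 2) * (a2 * b1)
             + (real n + 1) * real n * (a1 * b2)"
    have "D_seq a1 b1 a2 b2 (Suc n) = a1 * b1 * (real n + 1)\<^sup>2 + ?r"
      by (simp add: D_seq_def power2_eq_square algebra_simps)
    moreover have "?r \<ge> 0"
      using assms by (intro add_nonneg_nonneg mult_nonneg_nonneg) auto
    ultimately show "- 2 * D_seq a1 b1 a2 b2 (Suc n) \<le> - (a1 * b1 * real n)"
      using lower[OF p(1), of ?r n] by simp
  qed
  show ?thesis
    unfolding K1_term_def by (intro summable_add summable_diff A B C D)
qed

lemma summable_K2_term:
  assumes "a1 > 0" "b1 > 0" "a2 > 0" "b2 > 0"
  shows "summable (\<lambda>n. K2_term a1 b1 a2 b2 (Suc n))"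
proof -
  define q where "q = 8 * a_plus a1 a2 * b_plus b1 b2"
  have q: "q > 0" using assms by (simp add: q_def a_plus_def b_plus_def)
  have k: "pi\<^sup>2 / q > 0" using q by simp
  have gauss: "summable (\<lambda>n. exp (- (pi\<^sup>2 * (y n)\<^sup>2) / q))"
    if y: "\<And>n. real n + 1 \<le> y n" for y :: "nat \<Rightarrow> real"
  proof (rule summable_exp_linear_bound[OF k])
    fix n
    have "real n \<le> (real n + 1)\<^sup>2" by (simp add: power2_eq_square algebra_simps)
    also have "\<dots> \<le> (y n)\<^sup>2" using y[of n] by (intro power_mono) auto
    finally have "pi\<^sup>2 / q * real n \<le> pi\<^sup>2 / q * (y n)\<^sup>2"
      using k by (intro mult_left_mono) auto
    then show "- (pi\<^sup>2 * (y n)\<^sup>2) / q \<le> - (pi\<^sup>2 / q * real n)" by simp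
  qed
  have bounded: "summable (\<lambda>n. f n * g n)"
    if f: "summable f" and pos: "\<And>n. 0 \<le> f n" and g: "\<And>n. \<bar>g n\<bar> \<le> 2"
    for f g :: "nat \<Rightarrow> real"
  proof (rule summable_comparison_test')
    show "summable (\<lambda>n. f n * 2)" using f by (rule summable_mult2)
    show "norm (f n * g n) \<le> f n * 2" if "n \<ge> 0" for n
      using mult_left_mono[OF g pos] pos[of n] by (simp add: abs_mult)
  qed
  have cos: "\<bar>cos x - cos y\<bar> \<le> 2" "\<bar>cos x + cos y\<bar> \<le> 2" for x y :: real
    using abs_cos_le_one[of x] abs_cos_le_one[of y] by linarith+
  show ?thesis
    unfolding K2_term_def Let_def q_def[symmetric]
    by (intro summable_add bounded gauss cos) auto
qed

lemma sum_tendsto_suminf_Suc: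
  fixes f :: "nat \<Rightarrow> real"
  assumes "summable (\<lambda>n. f (Suc n))"
  shows "(\<lambda>N. \<Sum>n = 1..N. f n) \<longlonglongrightarrow> (\<Sum>n. f (Suc n))"
proof -
  have "(\<Sum>n = 1..N. f n) = (\<Sum>n<N. f (Suc n))" for N
    by (simp add: sum.atLeast1_atMost_eq)
  then show ?thesis using summable_LIMSEQ[OF assms] by simp
qed

lemma K1_tendsto_K1_inf:
  assumes "a1 > 0" "b1 > 0" "a2 > 0" "b2 > 0"
  shows "K1 a1 b1 a2 b2 \<longlonglongrightarrow> K1_inf a1 b1 a2 b2"
  unfolding K1_def[abs_def] K1_inf_def
  by (intro tendsto_diff tendsto_const sum_tendsto_suminf_Suc summable_K1_term assms)

lemma K2_tendsto_K2_inf: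
  assumes "a1 > 0" "b1 > 0" "a2 > 0" "b2 > 0"
  shows "K2 a1 b1 a2 b2 \<longlonglongrightarrow> K2_inf a1 b1 a2 b2"
  unfolding K2_def[abs_def] K2_inf_def
  by (intro tendsto_mult_left sum_tendsto_suminf_Suc summable_K2_term assms)

end

(*  Both remainders are tails of Gaussian-like series. Since (M + k)^2 >= M^2 + 2 M k,
    such a tail is dominated by a geometric series with ratio r = exp (- 2 s M), and
    r / (1 - r) <= 1 / (2 s M). *)
theory Submission
  imports Defs
begin

text \<open>The quotient is 1 / (e^x - 1), and e^x >= 1 + x. This turns the sum of the dominating
  geometric series into the rational prefactor of both bounds.\<close>

lemma geometric_exp_le_inverse:
  fixes x :: real
  assumes "x > 0"
  shows "exp (- x) / (1 - exp (- x)) \<le> 1 / x"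
proof -
  have "exp (- x) / (1 - exp (- x)) = 1 / (exp x - 1)"
    using assms by (simp add: exp_minus field_simps)
  also have "\<dots> \<le> 1 / x"
    using assms exp_ge_add_one_self[of x] by (intro divide_left_mono mult_pos_pos) linarith+
  finally show ?thesis .
qed

lemma gauss_le_geometric:
  fixes s x M :: real
  assumes "s \<ge> 0" "M \<ge> 0" "M + real k \<le> x"
  shows "exp (- (s * x\<^sup>2)) \<le> exp (- (s * M\<^sup>2)) * exp (- (2 * s * M)) ^ k"
proof -
  have "M\<^sup>2 + 2 * M * real k \<le> (M + real k)\<^sup>2"
    by (simp add: power2_sum)
  also have "\<dots> \<le> x\<^sup>2"
    using assms by (intro power_mono) auto
  finally have "s * (M\<^sup>2 + 2 * M * real k) \<le> s * x\<^sup>2"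
    using assms(1) by (rule mult_left_mono)
  then have "exp (- (s * x\<^sup>2)) \<le> exp (- (s * M\<^sup>2) + real k * - (2 * s * M))"
    by (simp add: algebra_simps)
  then show ?thesis
    by (simp only: exp_add exp_of_nat_mult)
qed

text \<open>Only upper bounds on the remainders are claimed, so a one-sided termwise bound is
  enough; \<open>f\<close> may take either sign.\<close>

lemma tail_le_geometric:
  fixes f :: "nat \<Rightarrow> real"
  assumes sm: "summable (\<lambda>n. f (Suc n))"
    and le: "\<And>k. f (Suc (k + N)) \<le> C * q ^ k" and q: "0 \<le> q" "q < 1"
  shows "(\<Sum>n. f (Suc n)) - (\<Sum>n = 1..N. f n) \<le> C / (1 - q)"
proof -
  have "(\<Sum>n. f (Suc n)) - (\<Sum>n = 1..N. f n) = (\<Sum>k. f (Suc (k + N)))"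
    using suminf_minus_initial_segment[OF sm, of N] by (simp add: sum.atLeast1_atMost_eq)
  also have "\<dots> \<le> (\<Sum>k. C * q ^ k)"
    using le q summable_ignore_initial_segment[OF sm, of N]
    by (intro suminf_le summable_mult summable_geometric) auto
  also have "\<dots> = C / (1 - q)"
    using q by (simp add: suminf_mult suminf_geometric)
  finally show ?thesis .
qed

lemma four_a_plus_b_plus:
  "4 * a_plus a1 a2 * b_plus b1 b2 = a1 * b1 + a2 * b2 + a1 * b2 + a2 * b1"
  by (simp add: a_plus_def b_plus_def field_simps)

text \<open>With \<open>n\<close> in place of \<open>Suc n\<close> this can fail, since C_n = 4 a_+
  b_+ n^2 + n (a1 b2 - a2 b1) and D_n has the opposite sign in the last term. Lowering the square by
  one index leaves only products with nonnegative coefficients. This shift is the source of N - 1 in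
  the first bound.\<close>

lemma C_seq_D_seq_ge:
  assumes "a1 > 0" "b1 > 0" "a2 > 0" "b2 > 0"
  shows "4 * a_plus a1 a2 * b_plus b1 b2 * (real n)\<^sup>2 \<le> C_seq a1 b1 a2 b2 (Suc n)"
    and "4 * a_plus a1 a2 * b_plus b1 b2 * (real n)\<^sup>2 \<le> D_seq a1 b1 a2 b2 (Suc n)"
proof -
  have nn: "0 \<le> a1 * b1" "0 \<le> a2 * b2" "0 \<le> a1 * b2" "0 \<le> a2 * b1"
    using assms by auto
  have "C_seq a1 b1 a2 b2 (Suc n) = 4 * a_plus a1 a2 * b_plus b1 b2 * (real n)\<^sup>2
      + (a1 * b1 + a2 * b2) * (2 * real n + 1) + (a2 * b1) * real n + (a1 * b2) * (3 * real n + 2)"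
    unfolding four_a_plus_b_plus C_seq_def by (simp add: power2_eq_square algebra_simps)
  then show "4 * a_plus a1 a2 * b_plus b1 b2 * (real n)\<^sup>2 \<le> C_seq a1 b1 a2 b2 (Suc n)"
    using nn by simp
  have "D_seq a1 b1 a2 b2 (Suc n) = 4 * a_plus a1 a2 * b_plus b1 b2 * (real n)\<^sup>2
      + (a1 * b1 + a2 * b2) * (2 * real n + 1) + (a1 * b2) * real n + (a2 * b1) * (3 * real n + 2)"
    unfolding four_a_plus_b_plus D_seq_def by (simp add: power2_eq_square algebra_simps)
  then show "4 * a_plus a1 a2 * b_plus b1 b2 * (real n)\<^sup>2 \<le> D_seq a1 b1 a2 b2 (Suc n)"
    using nn by simp
qed

lemma R1_le:
  assumes pos: "a1 > 0" "b1 > 0" "a2 > 0" "b2 > 0" and N: "N > 1"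
  shows "R1 a1 b1 a2 b2 N
           \<le> 1 / (4 * a_plus a1 a2 * b_plus b1 b2 * (real N - 1))
              * exp (- 8 * a_plus a1 a2 * b_plus b1 b2 * (real N - 1)\<^sup>2)"
proof -
  define p where "p = 4 * a_plus a1 a2 * b_plus b1 b2"
  \<comment> \<open>The tail starts at n = N + 1, hence with the square N^2 = (M + 1)^2. Starting
    one step past M yields r / (1 - r) rather than 1 / (1 - r), and N > 1 makes M positive, so r <
    1.\<close>
  define M where "M = real N - 1"
  define r where "r = exp (- (2 * (2 * p) * M))"
  define G where "G = exp (- (2 * p * M\<^sup>2))"
  have p: "p > 0" using pos by (simp add: p_def a_plus_def b_plus_def)
  have M: "M > 0" using N by (simp add: M_def)
  have r: "0 \<le> r" "r < 1" using p M by (simp_all add: r_def)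
  have G: "G > 0" by (simp add: G_def)
  have le: "- K1_term a1 b1 a2 b2 (Suc (k + N)) \<le> (2 * G * r) * r ^ k" for k
  proof -
    have g: "exp (- (2 * p * (real (k + N))\<^sup>2)) \<le> G * r ^ Suc k"
      unfolding G_def r_def using p M by (intro gauss_le_geometric) (auto simp: M_def)
    have "exp (- 2 * C_seq a1 b1 a2 b2 (Suc (k + N))) \<le> exp (- (2 * p * (real (k + N))\<^sup>2))"
         "exp (- 2 * D_seq a1 b1 a2 b2 (Suc (k + N))) \<le> exp (- (2 * p * (real (k + N))\<^sup>2))"
      using C_seq_D_seq_ge[OF pos, of "k + N"] unfolding p_def[symmetric] by simp_all
    moreover have "0 < exp (- 2 * A_seq a1 b1 a2 b2 (Suc (k + N)))"
      "0 < exp (- 2 * B_seq a1 b1 a2 b2 (Suc (k + N)))" by simp_all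
    ultimately have "- K1_term a1 b1 a2 b2 (Suc (k + N)) \<le> 2 * (G * r ^ Suc k)"
      using g unfolding K1_term_def by linarith
    then show ?thesis by (simp add: mult_ac)
  qed
  have sm: "summable (\<lambda>n. K1_term a1 b1 a2 b2 (Suc n))"
    by (rule summable_K1_term[OF pos])
  have "R1 a1 b1 a2 b2 N
      = (\<Sum>n. - K1_term a1 b1 a2 b2 (Suc n)) - (\<Sum>n = 1..N. - K1_term a1 b1 a2 b2 n)"
    by (simp add: R1_def K1_def K1_inf_def suminf_minus[OF sm] sum_negf)
  also have "\<dots> \<le> 2 * G * r / (1 - r)"
    using sm le r by (intro tail_le_geometric) (simp_all add: summable_minus)
  also have "\<dots> = 2 * G * (r / (1 - r))" by simp
  also have "\<dots> \<le> 2 * G * (1 / (2 * (2 * p) * M))"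
    unfolding r_def using G p M by (intro mult_left_mono geometric_exp_le_inverse) auto
  \<comment> \<open>The left side equals G / (2 p M), so a factor 2 is given away here.\<close>
  also have "\<dots> \<le> 1 / (p * M) * G"
    using G p M by (simp add: field_simps)
  also have "G = exp (- 8 * a_plus a1 a2 * b_plus b1 b2 * (real N - 1)\<^sup>2)"
    by (simp add: G_def p_def M_def)
  finally show ?thesis unfolding p_def M_def .
qed

text \<open>Here 2 q is half the sum of all four products a_i b_j, while d is half the difference of
  two of them. So |d| <= 2 q, and d^2 / (2 q) <= 2 q.\<close>

lemma K2_factor_le:
  assumes pos: "a1 > 0" "b1 > 0" "a2 > 0" "b2 > 0"
  defines "q \<equiv> a_plus a1 a2 * b_plus b1 b2"
  shows "K2_factor a1 b1 a2 b2 \<le> sqrt (pi / (2 * q)) * exp (2 * q)"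
proof -
  define d where "d = d_par a1 b1 a2 b2"
  have q: "q > 0" using pos by (simp add: q_def a_plus_def b_plus_def)
  have nn: "0 \<le> a1 * b1" "0 \<le> a2 * b2" "0 \<le> a1 * b2" "0 \<le> a2 * b1"
    using pos by auto
  have "\<bar>d\<bar> \<le> 2 * q"
    using nn four_a_plus_b_plus[of a1 a2 b1 b2] by (simp add: d_def d_par_def q_def)
  then have "\<bar>d\<bar>\<^sup>2 \<le> (2 * q)\<^sup>2"
    by (intro power_mono) auto
  then have "d\<^sup>2 / (2 * q) \<le> 2 * q"
    using q by (simp add: field_simps power2_eq_square)
  then show ?thesis
    using q by (simp add: K2_factor_def Let_def d_def q_def mult.assoc mult_left_mono)
qed

text \<open>The two halves of \<open>K2_term\<close> are the even and odd terms m = 2n and m = 2n -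
  1 of one series with Gaussian weights exp (- s m^2), each multiplied by a cosine combination of
  modulus at most 2.\<close>

lemma R2_le:
  assumes pos: "a1 > 0" "b1 > 0" "a2 > 0" "b2 > 0" and N: "N > 1"
  shows "R2 a1 b1 a2 b2 N
           \<le> (2 / pi) powr (3 / 2) * (sqrt (a_plus a1 a2 * b_plus b1 b2) / real N)
              * exp (2 * a_plus a1 a2 * b_plus b1 b2)
              * exp (- (pi\<^sup>2 * (real N)\<^sup>2) / (2 * a_plus a1 a2 * b_plus b1 b2))"
proof -
  define q where "q = a_plus a1 a2 * b_plus b1 b2"
  define s where "s = pi\<^sup>2 / (8 * q)"
  \<comment> \<open>The tail n > N runs over m = M + 1, M + 2, and so on. With this M,
    \<open>G\<close> is exactly the last exponential of the claim.\<close>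
  define M where "M = 2 * real N"
  define r where "r = exp (- (2 * s * M))"
  define G where "G = exp (- (s * M\<^sup>2))"
  define T where "T = (\<Sum>n. K2_term a1 b1 a2 b2 (Suc n)) - (\<Sum>n = 1..N. K2_term a1 b1 a2 b2 n)"
  have q: "q > 0" using pos by (simp add: q_def a_plus_def b_plus_def)
  have s: "s > 0" using q by (simp add: s_def)
  have M: "M > 0" using N by (simp add: M_def)
  have r: "0 < r" "r < 1" using s M by (simp_all add: r_def)
  have r2: "0 \<le> r\<^sup>2" "r\<^sup>2 < 1" using r by (simp_all add: power_less_one_iff)
  have G: "G > 0" by (simp add: G_def)
  have cos: "\<bar>cos x - cos y\<bar> \<le> 2" "\<bar>cos x + cos y\<bar> \<le> 2" for x y :: real
    using abs_cos_le_one[of x] abs_cos_le_one[of y] by linarith+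
  have le: "K2_term a1 b1 a2 b2 (Suc (k + N)) \<le> (2 * G * (r + r\<^sup>2)) * (r\<^sup>2) ^ k" for k
  proof -
    let ?n = "real (Suc (k + N))"
    have mono: "exp (- (pi\<^sup>2 * x\<^sup>2) / (8 * a_plus a1 a2 * b_plus b1 b2)) * z \<le> G * r ^ j * 2"
      if "M + real j = x" "\<bar>z\<bar> \<le> 2" for x z j
    proof -
      have "exp (- (pi\<^sup>2 * x\<^sup>2) / (8 * a_plus a1 a2 * b_plus b1 b2)) = exp (- (s * x\<^sup>2))"
        by (simp add: s_def q_def mult.assoc)
      also have "\<dots> \<le> G * r ^ j"
        unfolding G_def r_def using s M that(1) by (intro gauss_le_geometric) auto
      finally have "exp (- (pi\<^sup>2 * x\<^sup>2) / (8 * a_plus a1 a2 * b_plus b1 b2)) * 2 \<le> G * r ^ j * 2"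
        by simp
      moreover have "exp (- (pi\<^sup>2 * x\<^sup>2) / (8 * a_plus a1 a2 * b_plus b1 b2)) * z
          \<le> exp (- (pi\<^sup>2 * x\<^sup>2) / (8 * a_plus a1 a2 * b_plus b1 b2)) * 2"
        using that(2) by (intro mult_left_mono) auto
      ultimately show ?thesis by linarith
    qed
    \<comment> \<open>For n = k + N + 1, 2n = M + (2k + 2) and 2n - 1 = M + (2k + 1).\<close>
    have "K2_term a1 b1 a2 b2 (Suc (k + N)) \<le> G * r ^ (2 * k + 2) * 2 + G * r ^ (2 * k + 1) * 2"
      unfolding K2_term_def Let_def
      by (intro add_mono mono cos) (simp_all add: M_def)
    also have "\<dots> = (2 * G * (r + r\<^sup>2)) * (r\<^sup>2) ^ k"
      by (simp add: power_add power_mult power2_eq_square algebra_simps)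
    finally show ?thesis .
  qed
  have "T \<le> 2 * G * (r + r\<^sup>2) / (1 - r\<^sup>2)"
    unfolding T_def using le r2 by (intro tail_le_geometric summable_K2_term pos)
  \<comment> \<open>The pairs form a series of ratio r^2; cancelling 1 + r restores the single
    series of ratio r over all m.\<close>
  also have "\<dots> = 2 * G * (r / (1 - r))"
  proof -
    have "r + r\<^sup>2 = r * (1 + r)" "1 - r\<^sup>2 = (1 - r) * (1 + r)"
      by (simp_all add: power2_eq_square algebra_simps)
    then show ?thesis using r by simp
  qed
  also have "\<dots> \<le> 2 * G * (1 / (2 * s * M))"
    unfolding r_def using G s M by (intro mult_left_mono geometric_exp_le_inverse) auto
  also have "\<dots> = 4 * q / (pi\<^sup>2 * real N) * G"
    using q N by (simp add: s_def M_def field_simps)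
  finally have T: "T \<le> 4 * q / (pi\<^sup>2 * real N) * G" .
  have K: "0 \<le> K2_factor a1 b1 a2 b2"
    using q by (simp add: K2_factor_def Let_def q_def mult.assoc)
  have const: "sqrt (pi / (2 * q)) * (4 * q / pi\<^sup>2) = (2 / pi) powr (3 / 2) * sqrt q"
  proof -
    have "(2 / pi) powr (3 / 2) = (2 / pi) powr (1 + 1 / 2)"
      by simp
    also have "\<dots> = 2 / pi * sqrt (2 / pi)"
      by (subst powr_add) (simp add: powr_half_sqrt)
    finally have powr: "(2 / pi) powr (3 / 2) = 2 / pi * sqrt (2 / pi)" .
    \<comment> \<open>Written this way, the rational factor pi / (2 q) combines with 4 q / pi^2 to 2
      / pi, and the roots already have the required form.\<close>
    have "sqrt (pi / (2 * q)) = (pi / (2 * q)) * (sqrt (2 / pi) * sqrt q)"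
    proof (rule real_sqrt_unique)
      show "(pi / (2 * q) * (sqrt (2 / pi) * sqrt q))\<^sup>2 = pi / (2 * q)"
        using q by (simp add: power_mult_distrib power_divide) (simp add: power2_eq_square)
    qed (use q in simp)
    then show ?thesis
      using q by (simp add: powr power2_eq_square)
  qed
  have "R2 a1 b1 a2 b2 N = K2_factor a1 b1 a2 b2 * T"
    by (simp add: R2_def K2_def K2_inf_def T_def right_diff_distrib)
  \<comment> \<open>The sign of \<open>T\<close> is not known, so \<open>T\<close> is replaced by
    its nonnegative bound before \<open>K2_factor\<close> is enlarged.\<close>
  also have "\<dots> \<le> K2_factor a1 b1 a2 b2 * (4 * q / (pi\<^sup>2 * real N) * G)"
    using T K by (rule mult_left_mono)
  also have "\<dots> \<le> sqrt (pi / (2 * q)) * exp (2 * q) * (4 * q / (pi\<^sup>2 * real N) * G)"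
    using K2_factor_le[OF pos] q G unfolding q_def by (intro mult_right_mono) auto
  also have "\<dots> = sqrt (pi / (2 * q)) * (4 * q / pi\<^sup>2) / real N * exp (2 * q) * G"
    by simp
  also have "\<dots> = (2 / pi) powr (3 / 2) * (sqrt q / real N) * exp (2 * q) * G"
    unfolding const by simp
  also have "G = exp (- (pi\<^sup>2 * (real N)\<^sup>2) / (2 * q))"
    by (simp add: G_def s_def M_def power_mult_distrib)
  finally show ?thesis by (simp add: q_def mult.assoc)
qed

theorem proposition3p1:
  fixes a1 b1 a2 b2 :: real and N :: nat
  assumes "a1 > 0" and "b1 > 0" and "a2 > 0" and "b2 > 0" and "N > 1"
  shows "R1 a1 b1 a2 b2 N
           \<le> 1 / (4 * a_plus a1 a2 * b_plus b1 b2 * (real N - 1))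
              * exp (- 8 * a_plus a1 a2 * b_plus b1 b2 * (real N - 1)\<^sup>2)
       \<and> R2 a1 b1 a2 b2 N
           \<le> (2 / pi) powr (3 / 2) * (sqrt (a_plus a1 a2 * b_plus b1 b2) / real N)
              * exp (2 * a_plus a1 a2 * b_plus b1 b2)
              * exp (- (pi\<^sup>2 * (real N)\<^sup>2) / (2 * a_plus a1 a2 * b_plus b1 b2))"
  using R1_le[OF assms] R2_le[OF assms] by (rule conjI)

end
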